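(* (1) $Bip^-(\mathcal{DML})=V(\mathbf{A}_5)$; (2) $R(Bip^-(\mathcal{DML}))=V(\mathbf{A}_5,\mathbf{IS}_2)$; (3) $B^-(\mathcal{DML})=V(\mathbf{A}_5,\mathbf{IS}_4)$.
   Context: All algebras have type $\langle 2,2,1\rangle$ ($\land,\lor,\lnot$). $\mathcal{DML}$ is the variety of De Morgan lattices (distributive lattices with $\lnot\lnot x\approx x$, $\lnot(x\land y)\approx\lnot x\lor\lnot y$, $\lnot(x\lor y)\approx\lnot x\land\lnot y$). Involutive semilattices (semilattices $\langle I,\lor\rangle$ with $\lnot\lnot x\approx x$, $\lnot(x\lor y)\approx\lnot x\lor\lnot y$) are viewed as type $\langle 2,2,1\rangle$ with $x\land y:=x\lor y$. $\mathbf{IS}_2=\{\mathbf{i}<\mathbf{j}\}$ with $\lnot$ identity. $\mathbf{IS}_4=\{\mathbf{i},\mathbf{j},\lnot\mathbf{j},\mathbf{k}\}$ with $\mathbf{i}$ bottom, $\mathbf{k}$ top, $\mathbf{j}\lor\lnot\mathbf{j}=\mathbf{k}$, $\lnot\mathbf{i}=\mathbf{i}$, $\lnot\mathbf{k}=\mathbf{k}$. $\mathbf{A}_5$ is the algebra with universe $\{a,b,a',b',u\}$ where $\{a,b\}$ is a 2-element lattice with $b<a$; $\{a',b'\}$ a 2-element lattice with $a'<b'$; $\lnot$ swaps $a\leftrightarrow a'$, $b\leftrightarrow b'$ and fixes $u$; and $x\land y=x\lor y=u$ whenever $x,y$ do not both lie in $\{a,b\}$ or both in $\{a',b'\}$.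 For a term $\varphi$, $Var(\varphi)$ is its set of variables and $Var^{+}(\varphi)$ (resp. $Var^-(\varphi)$) the set of variables occurring in the scope of an even (resp. odd) number of $\lnot$'s. An identity $\varphi\approx\psi$ is regular if $Var(\varphi)=Var(\psi)$; balanced regular if $Var^\pm(\varphi)=Var^\pm(\psi)$; bipolar if $Var^+(\varphi)\cap Var^-(\varphi)\ne\emptyset$ and $Var^+(\psi)\cap Var^-(\psi)\ne\emptyset$; bipolarly balanced if bipolar or balanced regular; regular bipolarly balanced if bipolar and regular, or balanced regular. For a variety $\mathcal{V}$: $Bip^-(\mathcal{V})$ is the variety satisfying all and only the bipolarly balanced identities that are either valid in $\mathcal{V}$ or bipolar; $R(Bip^-(\mathcal{V}))$ is the variety satisfying all and only the regular bipolarly balanced identities that are either valid in $\mathcal{V}$ or bipolar; $B^-(\mathcal{V})$ is the variety satisfying all and only the balanced regular identities that are either valid in $\mathcal{V}$ or bipolar. $V(\mathcal{K})$ is the variety generated by $\mathcal{K}$. *)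

theory Defs
  imports Main
begin

datatype (vars: 'v) trm =
    Var 'v
  | Meet "'v trm" "'v trm"
  | Join "'v trm" "'v trm"
  | Neg "'v trm"

text \<open>Variables occurring in the scope of an even, respectively odd, number of negations.\<close>

fun vars_pos :: "'v trm \<Rightarrow> 'v set" and vars_neg :: "'v trm \<Rightarrow> 'v set" where
  "vars_pos (Var x) = {x}"
| "vars_pos (Meet s t) = vars_pos s \<union> vars_pos t"
| "vars_pos (Join s t) = vars_pos s \<union> vars_pos t"
| "vars_pos (Neg t) = vars_neg t"
| "vars_neg (Var x) = {}"
| "vars_neg (Meet s t) = vars_neg s \<union> vars_neg t"
| "vars_neg (Join s t) = vars_neg s \<union> vars_neg t"
| "vars_neg (Neg t) = vars_pos t"

type_synonym identity = "nat trm \<times> nat trm"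

fun regular :: "identity \<Rightarrow> bool" where
  "regular (s, t) \<longleftrightarrow> vars s = vars t"

fun balanced_regular :: "identity \<Rightarrow> bool" where
  "balanced_regular (s, t) \<longleftrightarrow> vars_pos s = vars_pos t \<and> vars_neg s = vars_neg t"

fun bipolar :: "identity \<Rightarrow> bool" where
  "bipolar (s, t) \<longleftrightarrow> vars_pos s \<inter> vars_neg s \<noteq> {} \<and> vars_pos t \<inter> vars_neg t \<noteq> {}"

definition bipolarly_balanced :: "identity \<Rightarrow> bool" where
  "bipolarly_balanced e \<longleftrightarrow> bipolar e \<or> balanced_regular e"

definition regular_bipolarly_balanced :: "identity \<Rightarrow> bool" where
  "regular_bipolarly_balanced e \<longleftrightarrow> (bipolar e \<and> regular e) \<or> balanced_regular e"

text \<open>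
  The operations of an algebra are total on the ambient type; only their restrictions to the
  carrier matter. Classes of algebras are sets of algebras whose carriers are non-empty subsets
  of a fixed type, which plays the role of the set-theoretic universe.
\<close>

record 'a algebra =
  carrier :: "'a set"
  meet :: "'a \<Rightarrow> 'a \<Rightarrow> 'a"
  join :: "'a \<Rightarrow> 'a \<Rightarrow> 'a"
  neg :: "'a \<Rightarrow> 'a"

definition is_algebra :: "'a algebra \<Rightarrow> bool" where
  "is_algebra A \<longleftrightarrow> carrier A \<noteq> {} \<and>
     (\<forall>x\<in>carrier A. \<forall>y\<in>carrier A. meet A x y \<in> carrier A \<and> join A x y \<in> carrier A) \<and>
     (\<forall>x\<in>carrier A. neg A x \<in> carrier A)"

primrec interp :: "'a algebra \<Rightarrow> ('v \<Rightarrow> 'a) \<Rightarrow> 'v trm \<Rightarrow> 'a" where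
  "interp A \<rho> (Var x) = \<rho> x"
| "interp A \<rho> (Meet s t) = meet A (interp A \<rho> s) (interp A \<rho> t)"
| "interp A \<rho> (Join s t) = join A (interp A \<rho> s) (interp A \<rho> t)"
| "interp A \<rho> (Neg t) = neg A (interp A \<rho> t)"

fun satisfies :: "'a algebra \<Rightarrow> identity \<Rightarrow> bool" where
  "satisfies A (s, t) \<longleftrightarrow> (\<forall>\<rho>. range \<rho> \<subseteq> carrier A \<longrightarrow> interp A \<rho> s = interp A \<rho> t)"

definition identities :: "'a algebra set \<Rightarrow> identity set" where
  "identities K = {e. \<forall>A\<in>K. satisfies A e}"

definition models :: "identity set \<Rightarrow> 'a algebra set" where
  "models E = {A. is_algebra A \<and> (\<forall>e\<in>E. satisfies A e)}"

definition variety :: "'a algebra set \<Rightarrow> bool" where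
  "variety W \<longleftrightarrow> (\<exists>E. W = models E)"

definition variety_generated :: "'a algebra set \<Rightarrow> 'a algebra set" where
  "variety_generated K = \<Inter> {W. variety W \<and> K \<subseteq> W}"

definition DML :: "'a algebra set" where
  "DML = {A. is_algebra A \<and>
     (\<forall>x\<in>carrier A. \<forall>y\<in>carrier A. \<forall>z\<in>carrier A.
        meet A x y = meet A y x \<and>
        join A x y = join A y x \<and>
        meet A (meet A x y) z = meet A x (meet A y z) \<and>
        join A (join A x y) z = join A x (join A y z) \<and>
        meet A x (join A x y) = x \<and>
        join A x (meet A x y) = x \<and>
        meet A x (join A y z) = join A (meet A x y) (meet A x z) \<and>
        join A x (meet A y z) = meet A (join A x y) (join A x z) \<and>
        neg A (neg A x) = x \<and>
        neg A (meet A x y) = join A (neg A x) (neg A y) \<and>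
        neg A (join A x y) = meet A (neg A x) (neg A y))}"

definition Bip_identities :: "'a algebra set \<Rightarrow> identity set" where
  "Bip_identities V = {e. bipolarly_balanced e \<and> (e \<in> identities V \<or> bipolar e)}"

definition RBip_identities :: "'a algebra set \<Rightarrow> identity set" where
  "RBip_identities V = {e. regular_bipolarly_balanced e \<and> (e \<in> identities V \<or> bipolar e)}"

definition B_identities :: "'a algebra set \<Rightarrow> identity set" where
  "B_identities V = {e. balanced_regular e \<and> (e \<in> identities V \<or> bipolar e)}"

text \<open>
  A variety satisfying all and only the identities in a set \<open>E\<close> is necessarily \<open>models E\<close>;
  that such a variety exists amounts to \<open>identities (models E) = E\<close>.
\<close>

definition Bip_minus :: "'a algebra set \<Rightarrow> 'a algebra set" where
  "Bip_minus V = models (Bip_identities V)"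

definition R_Bip_minus :: "'a algebra set \<Rightarrow> 'a algebra set" where
  "R_Bip_minus V = models (RBip_identities V)"

definition B_minus :: "'a algebra set \<Rightarrow> 'a algebra set" where
  "B_minus V = models (B_identities V)"

text \<open>
  The finite algebras below are parametrised by their elements, which are meant to be pairwise
  distinct. In \<open>A5\<close> the two lattice orders are \<open>b < a\<close> and \<open>a' < b'\<close>.
\<close>

definition A5 :: "'a \<Rightarrow> 'a \<Rightarrow> 'a \<Rightarrow> 'a \<Rightarrow> 'a \<Rightarrow> 'a algebra" where
  "A5 a b a' b' u =
     \<lparr>carrier = {a, b, a', b', u},
      meet = (\<lambda>x y. if x \<in> {a, b} \<and> y \<in> {a, b} then (if x = a \<and> y = a then a else b)
                    else if x \<in> {a', b'} \<and> y \<in> {a', b'} then (if x = b' \<and> y = b' then b' else a')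
                    else u),
      join = (\<lambda>x y. if x \<in> {a, b} \<and> y \<in> {a, b} then (if x = b \<and> y = b then b else a)
                    else if x \<in> {a', b'} \<and> y \<in> {a', b'} then (if x = a' \<and> y = a' then a' else b')
                    else u),
      neg = (\<lambda>x. if x = a then a' else if x = a' then a
                 else if x = b then b' else if x = b' then b else u)\<rparr>"

definition IS2 :: "'a \<Rightarrow> 'a \<Rightarrow> 'a algebra" where
  "IS2 i j =
     \<lparr>carrier = {i, j},
      meet = (\<lambda>x y. if x = i \<and> y = i then i else j),
      join = (\<lambda>x y. if x = i \<and> y = i then i else j),
      neg = (\<lambda>x. x)\<rparr>"

text \<open>In \<open>IS4 i j nj k\<close> the element \<open>nj\<close> is the negation of \<open>j\<close>.\<close>

definition IS4_join :: "'a \<Rightarrow> 'a \<Rightarrow> 'a \<Rightarrow> 'a \<Rightarrow> 'a" where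
  "IS4_join i k x y = (if x = i then y else if y = i then x else if x = y then x else k)"

definition IS4 :: "'a \<Rightarrow> 'a \<Rightarrow> 'a \<Rightarrow> 'a \<Rightarrow> 'a algebra" where
  "IS4 i j nj k =
     \<lparr>carrier = {i, j, nj, k},
      meet = IS4_join i k,
      join = IS4_join i k,
      neg = (\<lambda>x. if x = j then nj else if x = nj then j else x)\<rparr>"

end

theory Submission
  imports Defs
begin

text \<open>
  Each of the three equalities amounts to computing the identities of finite algebras. A term takes
  a value other than \<open>u\<close> in \<open>A5\<close> only if its positive variables are all sent to one
  of the two chains and its negative variables to the other; in particular bipolar terms are
  constantly \<open>u\<close>. On such valuations \<open>A5\<close> computes the term as a lattice term in the
  literals \<open>x\<close> (\<open>x\<close> positive) and \<open>\<not>x\<close> (\<open>x\<close> negative) over the two-element lattice.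
  Hence, for non-bipolar terms, prime filters turn a failure of an identity in a De Morgan lattice
  into a failure in \<open>A5\<close>, and the converse passes through the two-element Boolean algebra.
  The algebras \<open>IS2\<close> and \<open>IS4\<close> satisfy precisely the regular, respectively the balanced
  regular identities.
\<close>

section \<open>Generated varieties and their identities\<close>

text \<open>\<open>models (identities K)\<close> is itself a variety and contains \<open>K\<close>,
  because the assumption makes every member of \<open>K\<close> a genuine algebra. Any variety
  containing \<open>K\<close> is cut out by identities valid in \<open>K\<close>, so it is at least
  as large.\<close>

lemma variety_generated_eq_models:
  assumes "\<And>A. A \<in> K \<Longrightarrow> is_algebra A"
  shows "variety_generated K = models (identities K)"
proof
  have "K \<subseteq> models (identities K)"
    using assms by (auto simp: models_def identities_def)
  then show "variety_generated K \<subseteq> models (identities K)"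
    unfolding variety_generated_def variety_def by blast
  show "models (identities K) \<subseteq> variety_generated K"
    unfolding variety_generated_def variety_def models_def identities_def by blast
qed

lemma identities_models_identities:
  fixes K :: "'a algebra set"
  assumes "\<And>A. A \<in> K \<Longrightarrow> is_algebra A"
  shows "identities (models (identities K) :: 'a algebra set) = identities K"
  using assms unfolding models_def identities_def by blast

text \<open>Once \<open>identities K\<close> is computed, both halves of each claim follow: the
  generated variety is \<open>models E\<close>, and its identities are all and only those in
  \<open>E\<close>.\<close>

lemma models_eq_variety_generated:
  fixes K :: "'a algebra set"
  assumes "\<And>A. A \<in> K \<Longrightarrow> is_algebra A" and "identities K = E"
  shows "models E = variety_generated K \<and> identities (models E :: 'a algebra set) = E"
  using variety_generated_eq_models identities_models_identities assms by metis

lemma vars_eq_pos_Un_neg: "vars t = vars_pos t \<union> vars_neg t"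
  by (induction t) auto

lemma balanced_regular_imp_regular: "balanced_regular e \<Longrightarrow> regular e"
  by (cases e) (simp add: vars_eq_pos_Un_neg)

lemma interp_in_carrier:
  assumes "is_algebra A" and "range \<rho> \<subseteq> carrier A"
  shows "interp A \<rho> t \<in> carrier A"
  using assms by (induction t) (auto simp: is_algebra_def)

section \<open>Prime filters of De Morgan lattices\<close>

text \<open>Characteristic functions of prime filters, that is, lattice homomorphisms into the
  two-element lattice. Constant functions are allowed, and \<open>P\<close> need not respect
  negation.\<close>

definition lattice_character :: "'a algebra \<Rightarrow> ('a \<Rightarrow> bool) \<Rightarrow> bool" where
  "lattice_character A P \<longleftrightarrow> (\<forall>x\<in>carrier A. \<forall>y\<in>carrier A.
     (P (meet A x y) \<longleftrightarrow> P x \<and> P y) \<and> (P (join A x y) \<longleftrightarrow> P x \<or> P y))"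

text \<open>The prime filter theorem: Zorn's lemma gives a filter maximal among those containing
  \<open>x\<close> and avoiding \<open>y\<close>, and distributivity makes it prime.\<close>

lemma lattice_character_separates_le:
  assumes A: "A \<in> DML" and x: "x \<in> carrier A" and y: "y \<in> carrier A"
    and nle: "meet A x y \<noteq> x"
  obtains P where "lattice_character A P" "P x" "\<not> P y"
proof -
  let ?L = "carrier A"
  let ?m = "meet A"
  let ?j = "join A"
  have cl: "\<And>p q. p \<in> ?L \<Longrightarrow> q \<in> ?L \<Longrightarrow> ?m p q \<in> ?L \<and> ?j p q \<in> ?L"
    using A by (auto simp: DML_def is_algebra_def)
  have comm: "\<And>p q. p \<in> ?L \<Longrightarrow> q \<in> ?L \<Longrightarrow> ?m p q = ?m q p \<and> ?j p q = ?j q p"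
    and assoc: "\<And>p q r. p \<in> ?L \<Longrightarrow> q \<in> ?L \<Longrightarrow> r \<in> ?L \<Longrightarrow> ?m (?m p q) r = ?m p (?m q r)"
    and abs: "\<And>p q. p \<in> ?L \<Longrightarrow> q \<in> ?L \<Longrightarrow> ?m p (?j p q) = p \<and> ?j p (?m p q) = p"
    and distr: "\<And>p q r. p \<in> ?L \<Longrightarrow> q \<in> ?L \<Longrightarrow> r \<in> ?L \<Longrightarrow> ?m p (?j q r) = ?j (?m p q) (?m p r)"
    using A unfolding DML_def by blast+
  have idem: "?m p p = p" if "p \<in> ?L" for p
    using that abs[of p "?m p p"] abs[of p p] cl by metis
  define le where "le p q \<longleftrightarrow> p \<in> ?L \<and> q \<in> ?L \<and> ?m p q = p" for p q
  have le_L: "le p q \<Longrightarrow> p \<in> ?L \<and> q \<in> ?L" for p q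
    by (simp add: le_def)
  have le_refl: "p \<in> ?L \<Longrightarrow> le p p" for p
    by (simp add: le_def idem)
  have le_trans: "le p r" if "le p q" "le q r" for p q r
    using that assoc[of p q r] unfolding le_def by metis
  have le_m1: "le (?m p q) p" if "p \<in> ?L" "q \<in> ?L" for p q
    unfolding le_def using that cl comm assoc idem by metis
  have le_m2: "le (?m p q) q" if "p \<in> ?L" "q \<in> ?L" for p q
    using le_m1[of q p] comm that by metis
  have m_greatest: "le r (?m p q)" if "le r p" "le r q" for p q r
    using that cl assoc[of r p q] unfolding le_def by metis
  have le_j1: "le p (?j p q)" if "p \<in> ?L" "q \<in> ?L" for p q
    using that cl abs unfolding le_def by metis
  have le_j2: "le q (?j p q)" if "p \<in> ?L" "q \<in> ?L" for p q
    using le_j1[of q p] comm that by metis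
  have le_iff_j: "le p q \<longleftrightarrow> ?j p q = q" if "p \<in> ?L" "q \<in> ?L" for p q
    using that abs[of q p] abs[of p q] comm[of p q] comm[of q "?m q p"] comm[of "?m q p" q] cl
    unfolding le_def by metis
  have j_least: "le (?j p q) r" if "le p r" "le q r" for p q r
  proof -
    have L: "p \<in> ?L" "q \<in> ?L" "r \<in> ?L" using that le_L by blast+
    have "?m r (?j p q) = ?j (?m r p) (?m r q)" using distr L by blast
    also have "\<dots> = ?j p q" using that comm L unfolding le_def by metis
    finally show ?thesis using L cl comm unfolding le_def by metis
  qed
  have m_mono: "le (?m p q) (?m p' q')" if "le p p'" "le q q'" for p q p' q'
    using that le_L m_greatest le_trans le_m1 le_m2 by meson
  define filt where "filt F \<longleftrightarrow> F \<subseteq> ?L \<and> x \<in> F \<and> (\<forall>p\<in>F. \<forall>q. le p q \<longrightarrow> q \<in> F) \<and>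
    (\<forall>p\<in>F. \<forall>q\<in>F. ?m p q \<in> F)" for F
  let ?C = "{F. filt F \<and> y \<notin> F}"
  \<comment> \<open>The principal filter of \<open>x\<close> avoids \<open>y\<close> because
    \<open>x\<close> is not below \<open>y\<close>; it serves as the bound of the empty
    chain.\<close>
  have up_x: "{q. le x q} \<in> ?C"
    using nle x le_refl le_trans m_greatest le_L by (auto simp: filt_def le_def[of x y])
  have "\<exists>M\<in>?C. \<forall>X\<in>?C. M \<subseteq> X \<longrightarrow> X = M"
  proof (rule subset_Zorn)
    fix \<C> assume chain: "subset.chain ?C \<C>"
    show "\<exists>U\<in>?C. \<forall>X\<in>\<C>. X \<subseteq> U"
    proof (cases "\<C> = {}")
      case True
      then show ?thesis using up_x by blast
    next
      case False
      have mem: "filt F \<and> y \<notin> F" if "F \<in> \<C>" for F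
        using chain that by (auto simp: subset.chain_def)
      have "?m p q \<in> \<Union>\<C>" if "F \<in> \<C>" "G \<in> \<C>" "p \<in> F" "q \<in> G" for p q F G
      proof -
        have "F \<subseteq> G \<or> G \<subseteq> F" using chain that by (auto simp: subset.chain_def)
        then show ?thesis using mem that unfolding filt_def by blast
      qed
      then have "\<Union>\<C> \<in> ?C"
        using False mem unfolding filt_def by blast
      then show ?thesis by blast
    qed
  qed
  then obtain M where M: "filt M" "y \<notin> M"
    and maximal: "\<And>F. filt F \<Longrightarrow> y \<notin> F \<Longrightarrow> M \<subseteq> F \<Longrightarrow> F = M"
    by blast
  have M_sub: "M \<subseteq> ?L" and xM: "x \<in> M" and M_up: "\<And>p q. p \<in> M \<Longrightarrow> le p q \<Longrightarrow> q \<in> M"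
    and M_m: "\<And>p q. p \<in> M \<Longrightarrow> q \<in> M \<Longrightarrow> ?m p q \<in> M"
    using M by (auto simp: filt_def)
  \<comment> \<open>The filter generated by \<open>M\<close> and \<open>v\<close> consists of the
    elements above some meet of \<open>v\<close> with a member of \<open>M\<close>. If it avoided
    \<open>y\<close>, maximality would make it equal to \<open>M\<close>, although \<open>v\<close>
    is not in \<open>M\<close>.\<close>
  have ext: "\<exists>n\<in>M. le (?m n v) y" if v: "v \<in> ?L" "v \<notin> M" for v
  proof (rule ccontr)
    assume neg: "\<not> (\<exists>n\<in>M. le (?m n v) y)"
    let ?F = "{w. \<exists>n\<in>M. le (?m n v) w}"
    have sub: "M \<subseteq> ?F" using M_sub v le_m1 by blast
    have closed: "?m p q \<in> ?F" if "n \<in> M" "le (?m n v) p" "n' \<in> M" "le (?m n' v) q" for n n' p q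
    proof -
      have L: "n \<in> ?L" "n' \<in> ?L" using M_sub that by auto
      have "le (?m (?m n n') v) (?m n v)" "le (?m (?m n n') v) (?m n' v)"
        using L v by (intro m_mono le_m1 le_m2 le_refl; simp)+
      then have "le (?m (?m n n') v) (?m p q)"
        using that by (blast intro: m_greatest le_trans)
      moreover have "?m n n' \<in> M" using M_m that by simp
      ultimately show ?thesis by blast
    qed
    have "filt ?F"
      unfolding filt_def using sub xM closed le_L le_trans by blast
    then have "?F = M" using maximal neg sub by blast
    moreover have "v \<in> ?F" using xM x v le_m2 by blast
    ultimately show False using v by blast
  qed
  \<comment> \<open>If both failed, a common \<open>?n\<close> in \<open>M\<close> would have its
    meets with \<open>v\<close> and with \<open>w\<close> below \<open>y\<close>. By distributivity
    its meet with the join, an element of \<open>M\<close>, would also be below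
    \<open>y\<close>.\<close>
  have prime: "v \<in> M \<or> w \<in> M" if vw: "v \<in> ?L" "w \<in> ?L" "?j v w \<in> M" for v w
  proof (rule ccontr)
    assume "\<not> (v \<in> M \<or> w \<in> M)"
    then obtain n n' where n: "n \<in> M" "le (?m n v) y" "n' \<in> M" "le (?m n' w) y"
      using ext vw by meson
    have L: "n \<in> ?L" "n' \<in> ?L" using M_sub n by auto
    let ?n = "?m n n'"
    have "le (?m ?n v) (?m n v)" "le (?m ?n w) (?m n' w)"
      using L vw by (intro m_mono le_m1 le_m2 le_refl; simp)+
    then have "le (?m ?n v) y" "le (?m ?n w) y"
      using n le_trans by blast+
    then have "le (?m ?n (?j v w)) y"
      using j_least distr[of ?n v w] L cl vw by simp
    moreover have "?m ?n (?j v w) \<in> M"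
      using M_m n vw by blast
    ultimately show False using M_up M(2) by blast
  qed
  have "lattice_character A (\<lambda>z. z \<in> M)"
    unfolding lattice_character_def
  proof (intro ballI conjI)
    fix p q assume L: "p \<in> ?L" "q \<in> ?L"
    show "?m p q \<in> M \<longleftrightarrow> p \<in> M \<and> q \<in> M" using M_m M_up L le_m1 le_m2 by blast
    show "?j p q \<in> M \<longleftrightarrow> p \<in> M \<or> q \<in> M" using M_up L le_j1 le_j2 prime by blast
  qed
  then show thesis using that xM M(2) by blast
qed

text \<open>By antisymmetry, one of two distinct elements is not below the other.\<close>

lemma lattice_character_separates:
  assumes "A \<in> DML" "x \<in> carrier A" "y \<in> carrier A" "x \<noteq> y"
  obtains P where "lattice_character A P" "P x \<noteq> P y"
proof -
  have "meet A x y = meet A y x" using assms by (simp add: DML_def)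
  then have "meet A x y \<noteq> x \<or> meet A y x \<noteq> y" using assms(4) by metis
  then show thesis using lattice_character_separates_le assms that by metis
qed

section \<open>The identities of A5\<close>

lemma is_algebra_A5: "is_algebra (A5 a b a' b' u)" (is "is_algebra ?A")
proof -
  have "meet ?A x y \<in> carrier ?A" "join ?A x y \<in> carrier ?A" "neg ?A x \<in> carrier ?A" for x y
    by (simp_all add: A5_def)
  moreover have "carrier ?A \<noteq> {}" by (simp add: A5_def)
  ultimately show ?thesis unfolding is_algebra_def by blast
qed

text \<open>A meet or join lies in a chain exactly when both arguments do, and negation exchanges
  the chains, so the two statements share one induction.\<close>

lemma A5_interp_chain:
  assumes "distinct [a, b, a', b', u]"
  shows "interp (A5 a b a' b' u) \<rho> t \<in> {a, b} \<longleftrightarrow>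
           \<rho> ` vars_pos t \<subseteq> {a, b} \<and> \<rho> ` vars_neg t \<subseteq> {a', b'}"
    and "interp (A5 a b a' b' u) \<rho> t \<in> {a', b'} \<longleftrightarrow>
           \<rho> ` vars_pos t \<subseteq> {a', b'} \<and> \<rho> ` vars_neg t \<subseteq> {a, b}"
proof (induction t)
  case (Meet s t)
  let ?A = "A5 a b a' b' u"
  have chain: "meet ?A x y \<in> {a, b} \<longleftrightarrow> x \<in> {a, b} \<and> y \<in> {a, b}"
    "meet ?A x y \<in> {a', b'} \<longleftrightarrow> x \<in> {a', b'} \<and> y \<in> {a', b'}" for x y
    using assms by (auto simp: A5_def)
  { case 1 show ?case
      by (simp only: interp.simps vars_pos.simps vars_neg.simps image_Un Un_subset_iff
          chain Meet.IH conj_ac) }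
  { case 2 show ?case
      by (simp only: interp.simps vars_pos.simps vars_neg.simps image_Un Un_subset_iff
          chain Meet.IH conj_ac) }
next
  case (Join s t)
  let ?A = "A5 a b a' b' u"
  have chain: "join ?A x y \<in> {a, b} \<longleftrightarrow> x \<in> {a, b} \<and> y \<in> {a, b}"
    "join ?A x y \<in> {a', b'} \<longleftrightarrow> x \<in> {a', b'} \<and> y \<in> {a', b'}" for x y
    using assms by (auto simp: A5_def)
  { case 1 show ?case
      by (simp only: interp.simps vars_pos.simps vars_neg.simps image_Un Un_subset_iff
          chain Join.IH conj_ac) }
  { case 2 show ?case
      by (simp only: interp.simps vars_pos.simps vars_neg.simps image_Un Un_subset_iff
          chain Join.IH conj_ac) }
next
  case (Neg t)
  let ?A = "A5 a b a' b' u"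
  have chain: "neg ?A x \<in> {a, b} \<longleftrightarrow> x \<in> {a', b'}" "neg ?A x \<in> {a', b'} \<longleftrightarrow> x \<in> {a, b}" for x
    using assms by (auto simp: A5_def)
  { case 1 show ?case
      by (simp only: interp.simps vars_pos.simps vars_neg.simps chain Neg.IH conj_ac) }
  { case 2 show ?case
      by (simp only: interp.simps vars_pos.simps vars_neg.simps chain Neg.IH conj_ac) }
qed simp_all

text \<open>The element \<open>u\<close> is the only one outside the two chains.\<close>

lemma A5_interp_not_chain:
  assumes d: "distinct [a, b, a', b', u]" and "range \<rho> \<subseteq> carrier (A5 a b a' b' u)"
    and "\<not> (\<rho> ` vars_pos t \<subseteq> {a, b} \<and> \<rho> ` vars_neg t \<subseteq> {a', b'})"
    and "\<not> (\<rho> ` vars_pos t \<subseteq> {a', b'} \<and> \<rho> ` vars_neg t \<subseteq> {a, b})"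
  shows "interp (A5 a b a' b' u) \<rho> t = u"
proof -
  have "interp (A5 a b a' b' u) \<rho> t \<in> {a, b} \<union> {a', b'} \<union> {u}"
    using interp_in_carrier[OF is_algebra_A5 assms(2), of t] by (auto simp: A5_def)
  then show ?thesis
    using assms A5_interp_chain[OF d, of \<rho> t] by blast
qed

text \<open>
  In the first case \<open>\<rho>\<close> codes the truth values of the literals of \<open>t\<close>, in the second
  case those of the literals of \<open>Neg t\<close>, with \<open>a\<close> and \<open>a'\<close> standing for true; the two cases
  are needed simultaneously because negation exchanges them.
\<close>

lemma A5_interp_character:
  fixes t :: "'v trm"
  assumes d: "distinct [a, b, a', b', u]" and A: "A \<in> DML"
    and \<sigma>: "range \<sigma> \<subseteq> carrier A" and P: "lattice_character A P"
  shows
    "\<lbrakk>\<And>x. x \<in> vars_pos t \<Longrightarrow> \<rho> x = (if P (\<sigma> x) then a else b);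
      \<And>x. x \<in> vars_neg t \<Longrightarrow> \<rho> x = (if P (neg A (\<sigma> x)) then a' else b')\<rbrakk>
     \<Longrightarrow> interp (A5 a b a' b' u) \<rho> t = (if P (interp A \<sigma> t) then a else b)"
    and "\<lbrakk>\<And>x. x \<in> vars_pos t \<Longrightarrow> \<rho> x = (if P (neg A (\<sigma> x)) then a' else b');
      \<And>x. x \<in> vars_neg t \<Longrightarrow> \<rho> x = (if P (\<sigma> x) then a else b)\<rbrakk>
     \<Longrightarrow> interp (A5 a b a' b' u) \<rho> t = (if P (neg A (interp A \<sigma> t)) then a' else b')"
proof (induction t)
  case (Var x)
  { case 1 then show ?case by simp }
  { case 2 then show ?case by simp }
next
  case (Meet s t)
  have L: "interp A \<sigma> s \<in> carrier A" "interp A \<sigma> t \<in> carrier A"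
    "neg A (interp A \<sigma> s) \<in> carrier A" "neg A (interp A \<sigma> t) \<in> carrier A"
    using A interp_in_carrier[of A, OF _ \<sigma>] by (auto simp: DML_def is_algebra_def)
  \<comment> \<open>On the second chain \<open>a'\<close> stands for true but lies below
    \<open>b'\<close>, so meet there acts as disjunction of truth values; De Morgan's law turns the
    negated meet into a join accordingly.\<close>
  have dm: "neg A (meet A (interp A \<sigma> s) (interp A \<sigma> t)) =
      join A (neg A (interp A \<sigma> s)) (neg A (interp A \<sigma> t))"
    using A L by (simp add: DML_def)
  { case 1
    have "interp (A5 a b a' b' u) \<rho> s = (if P (interp A \<sigma> s) then a else b)"
      "interp (A5 a b a' b' u) \<rho> t = (if P (interp A \<sigma> t) then a else b)"
      using 1 by (intro Meet.IH(1) Meet.IH(3); simp)+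
    then show ?case using d P L by (auto simp: A5_def lattice_character_def) }
  { case 2
    have "interp (A5 a b a' b' u) \<rho> s = (if P (neg A (interp A \<sigma> s)) then a' else b')"
      "interp (A5 a b a' b' u) \<rho> t = (if P (neg A (interp A \<sigma> t)) then a' else b')"
      using 2 by (intro Meet.IH(2) Meet.IH(4); simp)+
    then show ?case using d P L by (auto simp: A5_def lattice_character_def dm) }
next
  case (Join s t)
  have L: "interp A \<sigma> s \<in> carrier A" "interp A \<sigma> t \<in> carrier A"
    "neg A (interp A \<sigma> s) \<in> carrier A" "neg A (interp A \<sigma> t) \<in> carrier A"
    using A interp_in_carrier[of A, OF _ \<sigma>] by (auto simp: DML_def is_algebra_def)
  have dm: "neg A (join A (interp A \<sigma> s) (interp A \<sigma> t)) =
      meet A (neg A (interp A \<sigma> s)) (neg A (interp A \<sigma> t))"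
    using A L by (simp add: DML_def)
  { case 1
    have "interp (A5 a b a' b' u) \<rho> s = (if P (interp A \<sigma> s) then a else b)"
      "interp (A5 a b a' b' u) \<rho> t = (if P (interp A \<sigma> t) then a else b)"
      using 1 by (intro Join.IH(1) Join.IH(3); simp)+
    then show ?case using d P L by (auto simp: A5_def lattice_character_def) }
  { case 2
    have "interp (A5 a b a' b' u) \<rho> s = (if P (neg A (interp A \<sigma> s)) then a' else b')"
      "interp (A5 a b a' b' u) \<rho> t = (if P (neg A (interp A \<sigma> t)) then a' else b')"
      using 2 by (intro Join.IH(2) Join.IH(4); simp)+
    then show ?case using d P L by (auto simp: A5_def lattice_character_def dm) }
next
  case (Neg t)
  have "interp A \<sigma> t \<in> carrier A"
    using A interp_in_carrier[of A, OF _ \<sigma>] by (simp add: DML_def)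
  then have nn: "neg A (neg A (interp A \<sigma> t)) = interp A \<sigma> t"
    using A by (simp add: DML_def)
  { case 1
    have "interp (A5 a b a' b' u) \<rho> t = (if P (neg A (interp A \<sigma> t)) then a' else b')"
      using 1 by (intro Neg.IH(2); simp)
    then show ?case using d by (auto simp: A5_def) }
  { case 2
    have "interp (A5 a b a' b' u) \<rho> t = (if P (interp A \<sigma> t) then a else b)"
      using 2 by (intro Neg.IH(1); simp)
    then show ?case using d by (auto simp: A5_def nn) }
qed

text \<open>The two-element Boolean algebra with top \<open>a\<close> and bottom \<open>b\<close>,
  built on elements of the given type so that identities of \<open>DML\<close> over that type apply
  to it.\<close>

definition B2 :: "'a \<Rightarrow> 'a \<Rightarrow> 'a algebra" where
  "B2 a b =
     \<lparr>carrier = {a, b},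
      meet = (\<lambda>x y. if x = a \<and> y = a then a else b),
      join = (\<lambda>x y. if x = a \<or> y = a then a else b),
      neg = (\<lambda>x. if x = a then b else a)\<rparr>"

lemma B2_in_DML: "a \<noteq> b \<Longrightarrow> B2 a b \<in> DML"
  by (simp add: DML_def is_algebra_def B2_def)

lemma B2_character: "a \<noteq> b \<Longrightarrow> lattice_character (B2 a b) (\<lambda>x. x = a)"
  by (auto simp: lattice_character_def B2_def)

text \<open>A variable of both polarities would have to be sent into both chains, which are
  disjoint; hence both sides are constantly \<open>u\<close>.\<close>

lemma A5_satisfies_bipolar:
  assumes d: "distinct [a, b, a', b', u]" and "bipolar e"
  shows "satisfies (A5 a b a' b' u) e"
proof (cases e)
  case (Pair s t)
  have const: "interp (A5 a b a' b' u) \<rho> r = u"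
    if \<rho>: "range \<rho> \<subseteq> carrier (A5 a b a' b' u)" and bip: "vars_pos r \<inter> vars_neg r \<noteq> {}"
    for \<rho> and r :: "nat trm"
  proof -
    obtain x where "x \<in> vars_pos r" "x \<in> vars_neg r" using bip by blast
    moreover have "\<rho> x \<notin> {a, b} \<or> \<rho> x \<notin> {a', b'}" using d by auto
    ultimately show ?thesis
      by (intro A5_interp_not_chain[OF d \<rho>]; metis image_subset_iff)
  qed
  show ?thesis using assms(2) const by (simp add: Pair)
qed

text \<open>Balance makes both sides reach a given chain under the same valuations. There their
  values are read off from \<open>B2\<close>, where the sides agree; elsewhere both are
  \<open>u\<close>.\<close>

lemma A5_satisfies_balanced_regular:
  fixes a b a' b' u :: 'a
  assumes d: "distinct [a, b, a', b', u]" and bal: "balanced_regular e"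
    and valid: "e \<in> identities (DML :: 'a algebra set)"
  shows "satisfies (A5 a b a' b' u) e"
proof (cases e)
  case (Pair s t)
  have eq: "vars_pos s = vars_pos t" "vars_neg s = vars_neg t"
    using bal by (simp_all add: Pair)
  have ab: "a \<noteq> b" using d by simp
  show ?thesis unfolding Pair satisfies.simps
  proof (intro allI impI)
    fix \<rho> :: "nat \<Rightarrow> 'a" assume \<rho>: "range \<rho> \<subseteq> carrier (A5 a b a' b' u)"
    \<comment> \<open>This is the truth value of the variable itself: \<open>a'\<close> says that
      its negation is true, so \<open>b'\<close> makes the variable true. The default
      \<open>b\<close> at \<open>u\<close> is harmless, since in the two chain cases no variable of
      the terms is sent to \<open>u\<close>.\<close>
    define \<sigma> where "\<sigma> x = (if \<rho> x \<in> {a, b'} then a else b)" for x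
    have \<sigma>: "range \<sigma> \<subseteq> carrier (B2 a b)" by (auto simp: \<sigma>_def B2_def)
    have st: "interp (B2 a b) \<sigma> s = interp (B2 a b) \<sigma> t"
      using valid B2_in_DML[OF ab] \<sigma> by (auto simp: Pair identities_def)
    note char = A5_interp_character[OF d B2_in_DML[OF ab] \<sigma> B2_character[OF ab]]
    have up: "\<rho> x = (if \<sigma> x = a then a else b)" if "\<rho> x \<in> {a, b}" for x
      using that d by (auto simp: \<sigma>_def)
    have down: "\<rho> x = (if neg (B2 a b) (\<sigma> x) = a then a' else b')" if "\<rho> x \<in> {a', b'}" for x
      using that d by (auto simp: \<sigma>_def B2_def)
    consider "\<rho> ` vars_pos t \<subseteq> {a, b} \<and> \<rho> ` vars_neg t \<subseteq> {a', b'}"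
      | "\<rho> ` vars_pos t \<subseteq> {a', b'} \<and> \<rho> ` vars_neg t \<subseteq> {a, b}"
      | "\<not> (\<rho> ` vars_pos t \<subseteq> {a, b} \<and> \<rho> ` vars_neg t \<subseteq> {a', b'})"
        "\<not> (\<rho> ` vars_pos t \<subseteq> {a', b'} \<and> \<rho> ` vars_neg t \<subseteq> {a, b})"
      by blast
    then show "interp (A5 a b a' b' u) \<rho> s = interp (A5 a b a' b' u) \<rho> t"
    proof cases
      case 1
      have "interp (A5 a b a' b' u) \<rho> r = (if interp (B2 a b) \<sigma> r = a then a else b)"
        if "vars_pos r = vars_pos t" "vars_neg r = vars_neg t" for r
        using 1 that by (intro char(1) up down) auto
      then show ?thesis using eq st by simp
    next
      case 2
      have "interp (A5 a b a' b' u) \<rho> r = (if neg (B2 a b) (interp (B2 a b) \<sigma> r) = a then a' else b')"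
        if "vars_pos r = vars_pos t" "vars_neg r = vars_neg t" for r
        using 2 that by (intro char(2) up down) auto
      then show ?thesis using eq st by simp
    next
      case 3
      then show ?thesis
        using A5_interp_not_chain[OF d \<rho>] eq by metis
    qed
  qed
qed

text \<open>The valuation places \<open>s\<close> in the chain of \<open>a\<close>, which is
  possible because no variable of \<open>s\<close> has both polarities. Foreign variables go to
  \<open>u\<close>, so a foreign variable or a wrong polarity in \<open>t\<close> would take
  \<open>t\<close> out of that chain.\<close>

lemma A5_satisfies_vars_subset:
  assumes d: "distinct [a, b, a', b', u]" and sat: "satisfies (A5 a b a' b' u) (s, t)"
    and nb: "vars_pos s \<inter> vars_neg s = {}"
  shows "vars_pos t \<subseteq> vars_pos s \<and> vars_neg t \<subseteq> vars_neg s"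
proof -
  define \<rho> where "\<rho> x = (if x \<in> vars_pos s then a else if x \<in> vars_neg s then a' else u)" for x
  have \<rho>: "range \<rho> \<subseteq> carrier (A5 a b a' b' u)" by (auto simp: \<rho>_def A5_def)
  have "\<rho> ` vars_pos s \<subseteq> {a, b} \<and> \<rho> ` vars_neg s \<subseteq> {a', b'}"
    using nb by (auto simp: \<rho>_def)
  then have "interp (A5 a b a' b' u) \<rho> s \<in> {a, b}"
    by (simp only: A5_interp_chain[OF d])
  then have "interp (A5 a b a' b' u) \<rho> t \<in> {a, b}" using sat \<rho> by simp
  then have sub: "\<rho> ` vars_pos t \<subseteq> {a, b} \<and> \<rho> ` vars_neg t \<subseteq> {a', b'}"
    by (simp only: A5_interp_chain[OF d])
  have "x \<in> vars_pos s" if "\<rho> x \<in> {a, b}" for x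
    using that d by (auto simp: \<rho>_def split: if_splits)
  moreover have "x \<in> vars_neg s" if "\<rho> x \<in> {a', b'}" for x
    using that d by (auto simp: \<rho>_def split: if_splits)
  ultimately show ?thesis using sub by blast
qed

text \<open>It suffices that one side has no variable of both polarities: the inclusions then pass
  this property to the other side, and the reverse inclusions follow.\<close>

lemma A5_satisfies_imp_balanced_regular:
  assumes d: "distinct [a, b, a', b', u]" and sat: "satisfies (A5 a b a' b' u) e"
    and nb: "\<not> bipolar e"
  shows "balanced_regular e"
proof (cases e)
  case (Pair s t)
  have "vars_pos s \<inter> vars_neg s = {} \<or> vars_pos t \<inter> vars_neg t = {}"
    using nb by (auto simp: Pair)
  moreover have "satisfies (A5 a b a' b' u) (s, t)" "satisfies (A5 a b a' b' u) (t, s)"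
    using sat by (auto simp: Pair)
  ultimately show ?thesis
    using A5_satisfies_vars_subset[OF d, of s t] A5_satisfies_vars_subset[OF d, of t s]
    unfolding Pair balanced_regular.simps by blast
qed

text \<open>A failure in a De Morgan lattice is seen by some prime filter, and coding its truth
  values turns it into a failure in \<open>A5\<close>.\<close>

lemma A5_satisfies_imp_DML:
  assumes d: "distinct [a, b, a', b', u]" and sat: "satisfies (A5 a b a' b' u) e"
    and nb: "\<not> bipolar e"
  shows "e \<in> identities (DML :: 'b algebra set)"
proof (cases e)
  case (Pair s t)
  have eq: "vars_pos s = vars_pos t" "vars_neg s = vars_neg t"
    using A5_satisfies_imp_balanced_regular[OF assms] by (simp_all add: Pair)
  then have disj: "vars_pos t \<inter> vars_neg t = {}" using nb by (simp add: Pair)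
  have "interp A \<sigma> s = interp A \<sigma> t" if A: "A \<in> DML" and \<sigma>: "range \<sigma> \<subseteq> carrier A"
    for A :: "'b algebra" and \<sigma>
  proof (rule ccontr)
    assume "interp A \<sigma> s \<noteq> interp A \<sigma> t"
    moreover have "interp A \<sigma> r \<in> carrier A" for r
      using A interp_in_carrier \<sigma> by (auto simp: DML_def)
    ultimately obtain P where P: "lattice_character A P"
      and sep: "P (interp A \<sigma> s) \<noteq> P (interp A \<sigma> t)"
      using lattice_character_separates A by metis
    \<comment> \<open>Disjointness of the positive and negative variables lets a single valuation
      code all literals; the values outside \<open>t\<close> do not affect the terms in
      question.\<close>
    define \<rho> where "\<rho> x = (if x \<in> vars_pos t then (if P (\<sigma> x) then a else b)
      else (if P (neg A (\<sigma> x)) then a' else b'))" for x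
    have \<rho>: "range \<rho> \<subseteq> carrier (A5 a b a' b' u)" by (auto simp: \<rho>_def A5_def)
    have "interp (A5 a b a' b' u) \<rho> r = (if P (interp A \<sigma> r) then a else b)"
      if "vars_pos r = vars_pos t" "vars_neg r = vars_neg t" for r
      using that disj by (intro A5_interp_character(1)[OF d A \<sigma> P]) (auto simp: \<rho>_def)
    then have "(if P (interp A \<sigma> s) then a else b) = (if P (interp A \<sigma> t) then a else b)"
      using sat \<rho> eq by (metis Pair satisfies.simps)
    then show False using sep d by (auto split: if_splits)
  qed
  then show ?thesis by (simp add: Pair identities_def)
qed

lemma A5_satisfies_iff:
  fixes a b a' b' u :: 'a
  assumes "distinct [a, b, a', b', u]"
  shows "satisfies (A5 a b a' b' u) e \<longleftrightarrow> e \<in> Bip_identities (DML :: 'a algebra set)"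
  using A5_satisfies_bipolar[OF assms] A5_satisfies_balanced_regular[OF assms]
    A5_satisfies_imp_balanced_regular[OF assms] A5_satisfies_imp_DML[OF assms]
  unfolding Bip_identities_def bipolarly_balanced_def mem_Collect_eq by blast

section \<open>The identities of IS2 and IS4\<close>

lemma is_algebra_IS2: "is_algebra (IS2 i j)"
  by (auto simp: is_algebra_def IS2_def)

lemma IS2_satisfies_iff_regular:
  assumes "i \<noteq> j"
  shows "satisfies (IS2 i j) e \<longleftrightarrow> regular e"
proof (cases e)
  case (Pair s t)
  have eq_i: "interp (IS2 i j) \<rho> r = i \<longleftrightarrow> (\<forall>x\<in>vars r. \<rho> x = i)" for \<rho> and r :: "nat trm"
    using assms by (induction r) (auto simp: IS2_def)
  have "interp (IS2 i j) \<rho> r = (if \<forall>x\<in>vars r. \<rho> x = i then i else j)"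
    if "range \<rho> \<subseteq> carrier (IS2 i j)" for \<rho> and r :: "nat trm"
    using eq_i[of \<rho> r] interp_in_carrier[OF is_algebra_IS2 that, of r] by (auto simp: IS2_def)
  then have "satisfies (IS2 i j) e" if "vars s = vars t"
    using that by (simp add: Pair)
  moreover have "vars s = vars t" if sat: "satisfies (IS2 i j) e"
  proof -
    have "x \<in> vars s \<longleftrightarrow> x \<in> vars t" for x
    proof -
      \<comment> \<open>Since \<open>j\<close> is absorbing, a term takes the value \<open>j\<close>
        here exactly when \<open>x\<close> occurs in it.\<close>
      let ?\<rho> = "\<lambda>y. if y = x then j else i"
      have "range ?\<rho> \<subseteq> carrier (IS2 i j)" by (auto simp: IS2_def)
      then have "interp (IS2 i j) ?\<rho> s = i \<longleftrightarrow> interp (IS2 i j) ?\<rho> t = i"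
        using sat by (simp add: Pair)
      moreover have "(\<forall>y\<in>vars r. ?\<rho> y = i) \<longleftrightarrow> x \<notin> vars r" for r
        using assms by auto
      ultimately show ?thesis unfolding eq_i by blast
    qed
    then show ?thesis by blast
  qed
  ultimately show ?thesis by (auto simp: Pair)
qed

lemma is_algebra_IS4: "is_algebra (IS4 i j nj k)" (is "is_algebra ?A")
proof -
  have "meet ?A x y \<in> carrier ?A" "join ?A x y \<in> carrier ?A" "neg ?A x \<in> carrier ?A"
    if "x \<in> carrier ?A" "y \<in> carrier ?A" for x y
    using that by (auto simp: IS4_def IS4_join_def)
  moreover have "carrier ?A \<noteq> {}" by (simp add: IS4_def)
  ultimately show ?thesis unfolding is_algebra_def by simp
qed

text \<open>
  \<open>IS4\<close> is the square of the two-element semilattice with the swap as negation; membership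
  in \<open>{j, k}\<close> and in \<open>{nj, k}\<close> are the two coordinates.
\<close>

lemma IS4_interp_coordinates:
  assumes d: "distinct [i, j, nj, k]" and \<rho>: "range \<rho> \<subseteq> carrier (IS4 i j nj k)"
  shows "interp (IS4 i j nj k) \<rho> t \<in> {j, k} \<longleftrightarrow>
           (\<exists>x\<in>vars_pos t. \<rho> x \<in> {j, k}) \<or> (\<exists>x\<in>vars_neg t. \<rho> x \<in> {nj, k})"
    and "interp (IS4 i j nj k) \<rho> t \<in> {nj, k} \<longleftrightarrow>
           (\<exists>x\<in>vars_pos t. \<rho> x \<in> {nj, k}) \<or> (\<exists>x\<in>vars_neg t. \<rho> x \<in> {j, k})"
proof -
  let ?A = "IS4 i j nj k"
  have L: "interp ?A \<rho> r \<in> {i, j, nj, k}" for r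
    using interp_in_carrier[OF is_algebra_IS4 \<rho>, of r] by (simp add: IS4_def)
  \<comment> \<open>Each coordinate of a join is the disjunction of the corresponding
    coordinates.\<close>
  have op: "IS4_join i k x y \<in> {j, k} \<longleftrightarrow> x \<in> {j, k} \<or> y \<in> {j, k}"
    "IS4_join i k x y \<in> {nj, k} \<longleftrightarrow> x \<in> {nj, k} \<or> y \<in> {nj, k}"
    if "x \<in> {i, j, nj, k}" "y \<in> {i, j, nj, k}" for x y
    using that d by (auto simp: IS4_join_def)
  have swap: "neg ?A x \<in> {j, k} \<longleftrightarrow> x \<in> {nj, k}" "neg ?A x \<in> {nj, k} \<longleftrightarrow> x \<in> {j, k}" for x
    using d by (auto simp: IS4_def)
  have join: "interp ?A \<rho> (Join s t) = IS4_join i k (interp ?A \<rho> s) (interp ?A \<rho> t)"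
    "interp ?A \<rho> (Meet s t) = IS4_join i k (interp ?A \<rho> s) (interp ?A \<rho> t)" for s t
    by (simp_all add: IS4_def)
  have "(interp ?A \<rho> t \<in> {j, k} \<longleftrightarrow>
       (\<exists>x\<in>vars_pos t. \<rho> x \<in> {j, k}) \<or> (\<exists>x\<in>vars_neg t. \<rho> x \<in> {nj, k})) \<and>
     (interp ?A \<rho> t \<in> {nj, k} \<longleftrightarrow>
       (\<exists>x\<in>vars_pos t. \<rho> x \<in> {nj, k}) \<or> (\<exists>x\<in>vars_neg t. \<rho> x \<in> {j, k}))"
  proof (induction t)
    case (Meet s t)
    show ?case
      by (simp only: join op[OF L L] vars_pos.simps vars_neg.simps Meet.IH bex_Un disj_ac simp_thms)
  next
    case (Join s t)
    show ?case
      by (simp only: join op[OF L L] vars_pos.simps vars_neg.simps Join.IH bex_Un disj_ac simp_thms)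
  next
    case (Neg t)
    show ?case
      by (simp only: interp.simps swap vars_pos.simps vars_neg.simps Neg.IH disj_ac simp_thms)
  qed simp
  then show "interp ?A \<rho> t \<in> {j, k} \<longleftrightarrow>
       (\<exists>x\<in>vars_pos t. \<rho> x \<in> {j, k}) \<or> (\<exists>x\<in>vars_neg t. \<rho> x \<in> {nj, k})"
    "interp ?A \<rho> t \<in> {nj, k} \<longleftrightarrow>
       (\<exists>x\<in>vars_pos t. \<rho> x \<in> {nj, k}) \<or> (\<exists>x\<in>vars_neg t. \<rho> x \<in> {j, k})"
    by simp_all
qed

lemma IS4_satisfies_iff_balanced_regular:
  assumes d: "distinct [i, j, nj, k]"
  shows "satisfies (IS4 i j nj k) e \<longleftrightarrow> balanced_regular e"
proof (cases e)
  case (Pair s t)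
  let ?A = "IS4 i j nj k"
  have "vars_pos s = vars_pos t \<and> vars_neg s = vars_neg t" if sat: "satisfies ?A e"
  proof -
    have "(x \<in> vars_pos s \<longleftrightarrow> x \<in> vars_pos t) \<and> (x \<in> vars_neg s \<longleftrightarrow> x \<in> vars_neg t)" for x
    proof -
      \<comment> \<open>Only \<open>x\<close> has a nonzero coordinate, and only the first one. A
        positive occurrence of \<open>x\<close> shows in the first coordinate of the term, a
        negative one in the second.\<close>
      let ?\<rho> = "\<lambda>y. if y = x then j else i"
      have \<rho>: "range ?\<rho> \<subseteq> carrier ?A" by (auto simp: IS4_def)
      have "interp ?A ?\<rho> r \<in> {j, k} \<longleftrightarrow> x \<in> vars_pos r"
        "interp ?A ?\<rho> r \<in> {nj, k} \<longleftrightarrow> x \<in> vars_neg r" for r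
        unfolding IS4_interp_coordinates[OF d \<rho>] using d by auto
      moreover have "interp ?A ?\<rho> s = interp ?A ?\<rho> t"
        using sat \<rho> by (simp add: Pair)
      ultimately show ?thesis by metis
    qed
    then show ?thesis by blast
  qed
  moreover have "satisfies ?A e" if eq: "vars_pos s = vars_pos t" "vars_neg s = vars_neg t"
    unfolding Pair satisfies.simps
  proof (intro allI impI)
    fix \<rho> :: "nat \<Rightarrow> _" assume \<rho>: "range \<rho> \<subseteq> carrier ?A"
    have L: "interp ?A \<rho> r \<in> {i, j, nj, k}" for r
      using interp_in_carrier[OF is_algebra_IS4 \<rho>, of r] by (simp add: IS4_def)
    \<comment> \<open>An element is determined by its two coordinates.\<close>
    have eqI: "x = y" if "x \<in> {i, j, nj, k}" "y \<in> {i, j, nj, k}"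
      "x \<in> {j, k} \<longleftrightarrow> y \<in> {j, k}" "x \<in> {nj, k} \<longleftrightarrow> y \<in> {nj, k}" for x y
      using that d by auto
    show "interp ?A \<rho> s = interp ?A \<rho> t"
      by (rule eqI[OF L L]; simp only: IS4_interp_coordinates[OF d \<rho>] eq)
  qed
  ultimately show ?thesis by (auto simp: Pair)
qed

section \<open>The three varieties\<close>

theorem theorem4p10:
  fixes a b a' b' u i j nj k :: 'u
  assumes "infinite (UNIV :: 'u set)"
    and "distinct [a, b, a', b', u]"
    and "distinct [i, j, nj, k]"
  shows
    "(Bip_minus DML = variety_generated {A5 a b a' b' u} \<and>
      identities (Bip_minus (DML :: 'u algebra set)) = Bip_identities (DML :: 'u algebra set)) \<and>
     (R_Bip_minus DML = variety_generated {A5 a b a' b' u, IS2 i j} \<and>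
      identities (R_Bip_minus (DML :: 'u algebra set)) = RBip_identities (DML :: 'u algebra set)) \<and>
     (B_minus DML = variety_generated {A5 a b a' b' u, IS4 i j nj k} \<and>
      identities (B_minus (DML :: 'u algebra set)) = B_identities (DML :: 'u algebra set))"
proof -
  have "i \<noteq> j" using assms(3) by simp
  note sat = A5_satisfies_iff[OF assms(2)] IS2_satisfies_iff_regular[OF this]
    IS4_satisfies_iff_balanced_regular[OF assms(3)]
  have "identities {A5 a b a' b' u} = Bip_identities (DML :: 'u algebra set)"
    by (auto simp: identities_def sat)
  \<comment> \<open>Adding \<open>IS2\<close> intersects with the regular identities. The balanced
    regular ones all survive, being regular; of the bipolar ones only the regular remain.\<close>
  moreover have "identities {A5 a b a' b' u, IS2 i j} = RBip_identities (DML :: 'u algebra set)"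
    using balanced_regular_imp_regular
    by (auto simp: identities_def[of "{_, _}"] sat Bip_identities_def RBip_identities_def
        bipolarly_balanced_def regular_bipolarly_balanced_def)
  \<comment> \<open>Adding \<open>IS4\<close> intersects with the balanced regular identities, so a
    bipolar identity survives only if it is balanced.\<close>
  moreover have "identities {A5 a b a' b' u, IS4 i j nj k} = B_identities (DML :: 'u algebra set)"
    by (auto simp: identities_def[of "{_, _}"] sat Bip_identities_def B_identities_def
        bipolarly_balanced_def)
  ultimately show ?thesis
    unfolding Bip_minus_def R_Bip_minus_def B_minus_def
    by (intro conjI[OF _ conjI] models_eq_variety_generated)
      (auto simp: is_algebra_A5 is_algebra_IS2 is_algebra_IS4)
qed

end
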